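(* Let $X$ be a metric space admitting a contracting barycenter map, let $L\ge 0$ and let $\eta:S^1\to X$ be an $L$-Lipschitz map. Then there exists an $L$-Lipschitz map $f:H^2\to X$ with $f|_{S^1}=\eta$, where $H^2$ is the metric hemisphere with boundary circle $S^1$.
   Context: $H^2$ denotes the closed hemisphere of the unit round sphere $S^2\subset\mathbb{R}^3$ with the angular (spherical) distance $d_{S^2}$. Its boundary great circle is $S^1$, equipped with the restriction of $d_{S^2}$, which is the arc-length metric (total length $2\pi$). For a metric space $(X,d)$ let $\mathcal{P}(X)$ be the set of Borel probability measures on $X$ with separable support. For $\mu,\nu\in\mathcal{P}(X)$ let $\Pi(\mu,\nu)$ be the set of couplings, i.e. $K\in\mathcal{P}(X\times X)$ with marginals $\mu$ and $\nu$. The Wasserstein $1$-distance is $d_W(\mu,\nu)=\inf_{K\in\Pi(\mu,\nu)}\int_{X\times X}d(x,y)\,dK(x,y)$. $\mathcal{P}_1(X)$ is the set of $\mu\in\mathcal{P}(X)$ at finite $d_W$-distance from the Dirac measures, equipped with $d_W$. A contracting barycenter map on $X$ is a map $b:\mathcal{P}_1(X)\to X$ which is $1$-Lipschitz with respect to $d_W$ and satisfies $b(\delta_x)=x$ for every $x\in X$, where $\delta_x$ is the Dirac measure at $x$. *)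

theory Defs
  imports "HOL-Probability.Probability"
begin

definition measure_support :: "'a::topological_space measure \<Rightarrow> 'a set" where
  "measure_support M = {x. \<forall>U. open U \<and> x \<in> U \<longrightarrow> emeasure M U > 0}"

(* On a non-separable space the full-measure clause is not implied by the separability of
   the support in ZFC alone (real-valued measurable cardinals); as usual, "separable
   support" means that the measure lives on its support.
   Sigma-algebra: borel of the product topology when 'a is a product type, which may be
   larger than the product of the borel algebras. *)
definition borel_probs :: "'a::metric_space measure set" where
  "borel_probs = {M. sets M = sets borel \<and> prob_space M \<and>
     separable_space (top_of_set (measure_support M)) \<and>
     emeasure M (measure_support M) = 1}"

definition couplings ::
    "'a::metric_space measure \<Rightarrow> 'a measure \<Rightarrow> ('a \<times> 'a) measure set" where
  "couplings M N = {K \<in> borel_probs. distr K borel fst = M \<and> distr K borel snd = N}"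

definition wasserstein_dist ::
    "'a::metric_space measure \<Rightarrow> 'a measure \<Rightarrow> ennreal" where
  "wasserstein_dist M N = (INF K\<in>couplings M N. \<integral>\<^sup>+ z. ennreal (dist (fst z) (snd z)) \<partial>K)"

(* return borel x is the Dirac measure at x *)
definition borel_probs1 :: "'a::metric_space measure set" where
  "borel_probs1 = {M \<in> borel_probs. \<forall>x. wasserstein_dist M (return borel x) < \<infinity>}"

definition contracting_barycenter_map :: "('a::metric_space measure \<Rightarrow> 'a) \<Rightarrow> bool" where
  "contracting_barycenter_map b \<longleftrightarrow>
     (\<forall>M\<in>borel_probs1. \<forall>N\<in>borel_probs1. ennreal (dist (b M) (b N)) \<le> wasserstein_dist M N) \<and>
     (\<forall>x. b (return borel x) = x)"

(* the angular distance; meaningful on unit vectors only *)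
definition sphere_dist :: "real^3 \<Rightarrow> real^3 \<Rightarrow> real" where
  "sphere_dist x y = arccos (x \<bullet> y)"

definition hemisphere :: "(real^3) set" where
  "hemisphere = {x \<in> sphere 0 1. x $ 3 \<ge> 0}"

definition boundary_circle :: "(real^3) set" where
  "boundary_circle = {x \<in> sphere 0 1. x $ 3 = 0}"

(* lipschitz_on with sphere_dist in place of the Euclidean dist on the domain *)
definition sphere_lipschitz_on :: "real \<Rightarrow> (real^3) set \<Rightarrow> (real^3 \<Rightarrow> 'a::metric_space) \<Rightarrow> bool" where
  "sphere_lipschitz_on L S f \<longleftrightarrow>
     0 \<le> L \<and> (\<forall>x\<in>S. \<forall>y\<in>S. dist (f x) (f y) \<le> L * sphere_dist x y)"

end

theory Submission
  imports Defs "HOL-Real_Asymp.Real_Asymp"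
begin

text \<open>
Project the hemisphere radially onto its boundary circle from a random centre: the great circle
ray from the centre through \<open>p\<close> hits the circle in a random point, and \<open>f p\<close> is the
barycenter of the law of the image of that point under \<open>\<eta>\<close>. Boundary points do not move, so
\<open>f\<close> extends \<open>\<eta>\<close>. If the vertical projection of the centre is uniform in the unit disc, the
expected distance between the images of \<open>p\<close> and \<open>q\<close> is exactly the spherical distance of \<open>p\<close>
and \<open>q\<close>, so the coupling that uses the same centre for both points shows that \<open>f\<close> is
\<open>L\<close>-Lipschitz.

In gnomonic coordinates the centre \<open>w\<close> is a point of the plane with density
\<open>1 / (\<pi> (1 + |w|\<^sup>2)\<^sup>2)\<close>, and the distance between the images is the angle at which the segment
from \<open>p\<close> to \<open>q\<close> is seen from \<open>w\<close>. This angle is the integral of an angular speed along the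
segment, and integrating the speed over \<open>w\<close>, along the lines through a fixed point of the
segment, gives the angular speed of the segment as seen from the origin of three-space.
\<close>

section \<open>Integrals involving a quadratic polynomial\<close>

lemma nn_integral_FTC_atMost:
  fixes f F :: "real \<Rightarrow> real"
  assumes [measurable]: "f \<in> borel_measurable borel"
  assumes f: "\<And>x. x \<le> a \<Longrightarrow> DERIV F x :> f x"
  assumes nonneg: "\<And>x. x \<le> a \<Longrightarrow> 0 \<le> f x"
  assumes lim: "(F \<longlongrightarrow> T) at_bot"
  shows "(\<integral>\<^sup>+x. ennreal (f x) * indicator {..a} x \<partial>lborel) = F a - T"
proof -
  have "(\<integral>\<^sup>+x. ennreal (f x) * indicator {..a} x \<partial>lborel) =
        (\<integral>\<^sup>+x. ennreal (f (- x)) * indicator {- a..} x \<partial>lborel)"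
    by (subst nn_integral_real_affine[where c="-1" and t=0])
       (auto intro!: nn_integral_cong simp: indicator_def)
  also have "\<dots> = ennreal (- T - - F (- (- a)))"
  proof (rule nn_integral_FTC_atLeast)
    show "((\<lambda>x. - F (- x)) has_real_derivative f (- x)) (at x)" if "- a \<le> x" for x
      using that f[of "- x"] by (auto intro!: derivative_eq_intros DERIV_chain2[of F])
    show "((\<lambda>x. - F (- x)) \<longlongrightarrow> - T) at_top"
      using lim by (auto intro!: tendsto_intros simp: filterlim_at_bot_mirror)
  qed (auto intro: nonneg)
  finally show ?thesis by simp
qed

lemma nn_integral_split_at:
  fixes f :: "real \<Rightarrow> ennreal"
  assumes [measurable]: "f \<in> borel_measurable borel"
  shows "(\<integral>\<^sup>+x. f x \<partial>lborel) =
    (\<integral>\<^sup>+x. f x * indicator {..a} x \<partial>lborel) + (\<integral>\<^sup>+x. f x * indicator {a..} x \<partial>lborel)"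
proof -
  have "(\<integral>\<^sup>+x. f x \<partial>lborel) = (\<integral>\<^sup>+x. f x * indicator {..a} x + f x * indicator {a..} x \<partial>lborel)"
    using AE_lborel_singleton[of a]
    by (intro nn_integral_cong_AE) (auto elim!: eventually_mono simp: indicator_def)
  then show ?thesis by (simp add: nn_integral_add)
qed

lemma nn_integral_FTC_real:
  fixes f F :: "real \<Rightarrow> real"
  assumes [measurable]: "f \<in> borel_measurable borel"
  assumes f: "\<And>x. DERIV F x :> f x"
  assumes nonneg: "\<And>x. 0 \<le> f x"
  assumes bot: "(F \<longlongrightarrow> A) at_bot" and top: "(F \<longlongrightarrow> B) at_top"
  shows "(\<integral>\<^sup>+x. ennreal (f x) \<partial>lborel) = ennreal (B - A)"
proof -
  \<comment> \<open>\<open>ennreal\<close> cuts negative numbers off at 0, so the half-line values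
    \<open>F 0 - A\<close> and \<open>B - F 0\<close> add up to \<open>B - A\<close> only once both
    are known to be nonnegative.\<close>
  have mono: "F x \<le> F y" if "x \<le> y" for x y
    using that f nonneg by (intro DERIV_nonneg_imp_nondecreasing[of x y F]) (auto intro: order_trans)
  have "A \<le> F 0"
    by (rule tendsto_upperbound[OF bot])
       (auto intro!: eventually_mono[OF eventually_le_at_bot[of 0]] mono)
  moreover have "F 0 \<le> B"
    by (rule tendsto_lowerbound[OF top])
       (auto intro!: eventually_mono[OF eventually_ge_at_top[of 0]] mono)
  ultimately show ?thesis
    by (subst nn_integral_split_at[where a=0], simp,
        subst nn_integral_FTC_atMost[where F=F and T=A],
        use assms in \<open>simp_all add: nn_integral_FTC_atLeast[where F=F and T=B] flip: ennreal_plus\<close>)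
qed

section \<open>Closed forms of two integrals over the real line\<close>

lemma quadratic_pos:
  fixes A B C x :: real
  assumes "A > 0" "A * C - B\<^sup>2 > 0"
  shows "A * x\<^sup>2 + 2 * B * x + C > 0"
proof -
  have "A * (A * x\<^sup>2 + 2 * B * x + C) = (A * x + B)\<^sup>2 + (A * C - B\<^sup>2)"
    by (simp add: power2_eq_square algebra_simps)
  also have "\<dots> > 0" using assms(2) by (simp add: add_nonneg_pos)
  finally show ?thesis using assms(1) by (simp add: zero_less_mult_iff)
qed

text \<open>The reduction formula for \<open>1 / q^2\<close> gives an explicit antiderivative. The
  purpose is to integrate the density of the centre along a line, where it is a constant over the
  square of a quadratic.\<close>

lemma nn_integral_inverse_quadratic_squared:
  fixes A B C :: real
  assumes A: "A > 0" and D: "A * C - B\<^sup>2 > 0"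
  shows "(\<integral>\<^sup>+x. ennreal (1 / (A * x\<^sup>2 + 2 * B * x + C)\<^sup>2) \<partial>lborel) =
    ennreal (A * pi / (2 * sqrt (A * C - B\<^sup>2) ^ 3))"
proof -
  define D where "D = A * C - B\<^sup>2"
  define q where "q x = A * x\<^sup>2 + 2 * B * x + C" for x
  \<comment> \<open>The rational term vanishes at both ends, so only the jump of
    \<open>arctan\<close> from \<open>- pi/2\<close> to \<open>pi/2\<close> contributes.\<close>
  define F where "F x = (A * x + B) / (2 * D * q x) + A / (2 * sqrt D ^ 3) * arctan ((A * x + B) / sqrt D)" for x
  have D0: "D > 0" using D by (simp add: D_def)
  have q0: "q x > 0" for x unfolding q_def by (rule quadratic_pos) fact+
  have qD: "D + (A * x + B)\<^sup>2 = A * q x" for x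
    by (simp add: q_def D_def power2_eq_square algebra_simps)
  have "(\<integral>\<^sup>+x. ennreal (1 / (q x)\<^sup>2) \<partial>lborel) = ennreal (A / (2 * sqrt D ^ 3) * (pi/2) - A / (2 * sqrt D ^ 3) * (- (pi/2)))"
  proof (rule nn_integral_FTC_real[where F=F])
    show "(\<lambda>x. 1 / (q x)\<^sup>2) \<in> borel_measurable borel" unfolding q_def by simp
    fix x
    have s: "sqrt D ^ 3 = D * sqrt D" using D0 by (simp add: power3_eq_cube)
    have dq: "(q has_real_derivative 2 * (A * x + B)) (at x)"
      unfolding q_def[abs_def] by (auto intro!: derivative_eq_intros simp: algebra_simps)
    have "(F has_real_derivative
       (A * (2 * D * q x) - (A * x + B) * (2 * D * (2 * (A * x + B)))) / ((2 * D * q x) * (2 * D * q x))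
        + A / (2 * sqrt D ^ 3) * (inverse (1 + ((A * x + B) / sqrt D)\<^sup>2) * (A / sqrt D))) (at x)"
      unfolding F_def[abs_def] using D0 q0[of x]
      by (intro DERIV_add DERIV_divide DERIV_cmult DERIV_chain2[OF DERIV_arctan] DERIV_cdivide dq)
         (auto intro!: derivative_eq_intros)
    also have "1 + ((A * x + B) / sqrt D)\<^sup>2 = A * q x / D"
      using D0 qD[of x] by (simp add: power_divide field_simps)
    also have "A / (2 * sqrt D ^ 3) * (inverse (A * q x / D) * (A / sqrt D)) = A / (2 * D * q x)"
      using D0 A q0[of x] unfolding s by (simp add: field_simps)
    also have "(A * (2 * D * q x) - (A * x + B) * (2 * D * (2 * (A * x + B)))) / ((2 * D * q x) * (2 * D * q x)) + A / (2 * D * q x)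
       = (A * q x - (A * x + B)\<^sup>2) / (D * (q x)\<^sup>2)"
      using D0 q0[of x] by (simp add: field_simps power2_eq_square)
    also have "\<dots> = 1 / (q x)\<^sup>2"
      using D0 unfolding qD[symmetric] by simp
    finally show "(F has_real_derivative 1 / (q x)\<^sup>2) (at x)" .
  next
    have lin: "filterlim (\<lambda>x. (A * x + B) / sqrt D) at_top at_top"
              "filterlim (\<lambda>x. (A * x + B) / sqrt D) at_bot at_bot"
      using D0 A by real_asymp+
    have quot: "((\<lambda>x. (A * x + B) / (2 * D * q x)) \<longlongrightarrow> 0) at_top"
               "((\<lambda>x. (A * x + B) / (2 * D * q x)) \<longlongrightarrow> 0) at_bot"
      using D0 A unfolding q_def by real_asymp+
    have "(F \<longlongrightarrow> 0 + A / (2 * sqrt D ^ 3) * (pi/2)) at_top"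
      unfolding F_def[abs_def]
      by (intro tendsto_add tendsto_mult tendsto_const quot filterlim_compose[OF tendsto_arctan_at_top] lin)
    then show "(F \<longlongrightarrow> A / (2 * sqrt D ^ 3) * (pi/2)) at_top" by simp
    have "(F \<longlongrightarrow> 0 + A / (2 * sqrt D ^ 3) * (- (pi/2))) at_bot"
      unfolding F_def[abs_def]
      by (intro tendsto_add tendsto_mult tendsto_const quot filterlim_compose[OF tendsto_arctan_at_bot] lin)
    then show "(F \<longlongrightarrow> A / (2 * sqrt D ^ 3) * (- (pi/2))) at_bot" by simp
  qed auto
  then show ?thesis by (simp add: q_def D_def)
qed

lemma linear_over_sqrt_quadratic_limits:
  fixes A B C k l :: real
  assumes "A > 0"
  shows "((\<lambda>x. (k * x + l) / sqrt (A * x\<^sup>2 + 2 * B * x + C)) \<longlongrightarrow> k / sqrt A) at_top"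
    and "((\<lambda>x. (k * x + l) / sqrt (A * x\<^sup>2 + 2 * B * x + C)) \<longlongrightarrow> - k / sqrt A) at_bot"
  using assms by (cases "k = 0"; real_asymp simp: field_simps powr_half_sqrt)+

text \<open>Without the absolute value there is an antiderivative of the form linear over
  \<open>sqrt q\<close>. For \<open>a = 0\<close> its limits at the two ends give the value;
  otherwise the integral is split at the root of the linear factor, the limits cancel, and minus
  twice the antiderivative at the root remains.\<close>

lemma nn_integral_abs_linear_over_quadratic:
  fixes A B C a b :: real
  assumes A: "A > 0" and D: "A * C - B\<^sup>2 > 0"
  shows "(\<integral>\<^sup>+x. ennreal (\<bar>a * x + b\<bar> / sqrt (A * x\<^sup>2 + 2 * B * x + C) ^ 3) \<partial>lborel) =
    ennreal (2 * sqrt (C * a\<^sup>2 - 2 * B * a * b + A * b\<^sup>2) / (A * C - B\<^sup>2))"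
proof -
  define D where "D = A * C - B\<^sup>2"
  define q where "q x = A * x\<^sup>2 + 2 * B * x + C" for x
  define N where "N = C * a\<^sup>2 - 2 * B * a * b + A * b\<^sup>2"
  have D0: "D > 0" using D by (simp add: D_def)
  have q0: "q x > 0" for x unfolding q_def by (rule quadratic_pos) fact+
  have dq: "(q has_real_derivative 2 * (A * x + B)) (at x)" for x
    unfolding q_def[abs_def] by (auto intro!: derivative_eq_intros simp: algebra_simps)
  have [measurable]: "q \<in> borel_measurable borel" unfolding q_def[abs_def] by simp
  \<comment> \<open>The coefficients come from matching the derivative of a linear function over
    \<open>sqrt q\<close> with the integrand. \<open>a\<close> and \<open>b\<close> stay arguments
    because \<open>F\<close> is used for several linear factors, including one and its
    negative.\<close>
  define F where "F a b x = ((A * b - B * a) * x + (B * b - C * a)) / D / sqrt (q x)" for a b x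
  have dF: "(F a b has_real_derivative (a * x + b) / sqrt (q x) ^ 3) (at x)" for a b x
  proof -
    define n where "n = (A * b - B * a) * x + (B * b - C * a)"
    have "(F a b has_real_derivative
      ((A * b - B * a) / D * sqrt (q x) - n / D * (inverse (sqrt (q x)) / 2 * (2 * (A * x + B)))) / (sqrt (q x) * sqrt (q x))) (at x)"
      unfolding F_def[abs_def] n_def using D0 q0[of x]
      by (intro DERIV_divide DERIV_chain2[OF DERIV_real_sqrt] DERIV_cdivide dq)
         (auto intro!: derivative_eq_intros)
    also have "((A * b - B * a) / D * sqrt (q x) - n / D * (inverse (sqrt (q x)) / 2 * (2 * (A * x + B)))) / (sqrt (q x) * sqrt (q x)) =
      ((A * b - B * a) * q x - n * (A * x + B)) / (D * sqrt (q x) ^ 3)"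
    proof -
      define r where "r = sqrt (q x)"
      have "r > 0" "q x = r * r" using q0[of x] by (simp_all add: r_def)
      then show ?thesis using D0 unfolding r_def[symmetric] by (simp add: field_simps power3_eq_cube)
    qed
    also have "(A * b - B * a) * q x - n * (A * x + B) = D * (a * x + b)"
      by (simp add: q_def n_def D_def power2_eq_square algebra_simps)
    finally show ?thesis using D0 by simp
  qed
  have Flim: "(F a b \<longlongrightarrow> (A * b - B * a) / D / sqrt A) at_top" "(F a b \<longlongrightarrow> - ((A * b - B * a) / D) / sqrt A) at_bot" for a b
    using linear_over_sqrt_quadratic_limits[OF A, of "(A * b - B * a) / D" "(B * b - C * a) / D" B C]
    by (simp_all add: F_def[abs_def] q_def add_divide_distrib)
  have "(\<integral>\<^sup>+x. ennreal (\<bar>a * x + b\<bar> / sqrt (q x) ^ 3) \<partial>lborel) = ennreal (2 * sqrt N / D)"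
  proof (cases "a = 0")
    case True
    have "(\<integral>\<^sup>+x. ennreal ((0 * x + \<bar>b\<bar>) / sqrt (q x) ^ 3) \<partial>lborel) =
       ennreal ((A * \<bar>b\<bar> - B * 0) / D / sqrt A - - ((A * \<bar>b\<bar> - B * 0) / D) / sqrt A)"
      by (intro nn_integral_FTC_real[OF _ dF _ Flim(2,1)]) (auto simp: q0 less_imp_le)
    also have "(A * \<bar>b\<bar> - B * 0) / D / sqrt A - - ((A * \<bar>b\<bar> - B * 0) / D) / sqrt A = 2 * sqrt N / D"
    proof -
      define r where "r = sqrt A"
      have "r > 0" "A = r * r" using A by (simp_all add: r_def)
      then show ?thesis using D0 unfolding r_def[symmetric]
        by (simp add: N_def True real_sqrt_mult)
    qed
    finally show ?thesis using True by simp
  next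
    case False
    \<comment> \<open>Multiplying by the sign of \<open>a\<close> keeps the absolute value and makes
      the slope positive, so the linear factor passes from negative to positive at its root
      \<open>c\<close>.\<close>
    define s where "s = sgn a"
    define a' where "a' = s * a"
    define b' where "b' = s * b"
    have a': "a' > 0" using False by (simp add: a'_def s_def sgn_if)
    have abs: "\<bar>a * x + b\<bar> = \<bar>a' * x + b'\<bar>" for x
      using False by (auto simp: a'_def b'_def s_def sgn_if)
    define c where "c = - b' / a'"
    have N': "N = C * a'\<^sup>2 - 2 * B * a' * b' + A * b'\<^sup>2"
      using False by (simp add: N_def a'_def b'_def s_def sgn_if)
    \<comment> \<open>This is where \<open>N\<close> comes from: up to the factor
      \<open>a'^2\<close> it is the value of \<open>q\<close> at the root, hence positive.\<close>
    have qc: "q c = N / a'\<^sup>2"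
      using a' by (simp add: q_def c_def N' field_simps power2_eq_square)
    have N0: "N > 0"
      using q0[of c] a' by (simp add: qc zero_less_divide_iff)
    have Fc: "F a' b' c = - sqrt N / D"
    proof -
      have "(A * b' - B * a') * c + (B * b' - C * a') = - N / a'"
        using a' by (simp add: c_def N' field_simps power2_eq_square)
      moreover have "sqrt (q c) = sqrt N / a'" using a' by (simp add: qc real_sqrt_divide)
      ultimately have "F a' b' c = - N / a' / D / (sqrt N / a')" by (simp only: F_def)
      also have "\<dots> = - (N / sqrt N) / D" using a' by simp
      finally show ?thesis using N0 by (simp add: real_div_sqrt)
    qed
    define M where "M = (A * b' - B * a') / D / sqrt A"
    have sgn_ge: "0 \<le> a' * x + b'" if "c \<le> x" for x
      using that a' by (simp add: c_def field_simps)
    have sgn_le: "a' * x + b' \<le> 0" if "x \<le> c" for x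
      using that a' by (simp add: c_def field_simps)
    have I1: "(\<integral>\<^sup>+x. ennreal (\<bar>a * x + b\<bar> / sqrt (q x) ^ 3) * indicator {c..} x \<partial>lborel) = ennreal (M - F a' b' c)"
    proof -
      have "(\<integral>\<^sup>+x. ennreal (\<bar>a * x + b\<bar> / sqrt (q x) ^ 3) * indicator {c..} x \<partial>lborel)
        = (\<integral>\<^sup>+x. ennreal ((a' * x + b') / sqrt (q x) ^ 3) * indicator {c..} x \<partial>lborel)"
        by (intro nn_integral_cong) (auto simp: indicator_def abs sgn_ge)
      also have "\<dots> = ennreal (M - F a' b' c)"
        unfolding M_def
        by (intro nn_integral_FTC_atLeast[OF _ dF _ Flim(1)]) (auto simp: q0 sgn_ge less_imp_le)
      finally show ?thesis .
    qed
    have I2: "(\<integral>\<^sup>+x. ennreal (\<bar>a * x + b\<bar> / sqrt (q x) ^ 3) * indicator {..c} x \<partial>lborel) = ennreal (- M - F a' b' c)"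
    proof -
      have "(\<integral>\<^sup>+x. ennreal (\<bar>a * x + b\<bar> / sqrt (q x) ^ 3) * indicator {..c} x \<partial>lborel)
        = (\<integral>\<^sup>+x. ennreal (((- a') * x + (- b')) / sqrt (q x) ^ 3) * indicator {..c} x \<partial>lborel)"
        by (intro nn_integral_cong) (use sgn_le in \<open>auto simp: indicator_def abs\<close>)
      also have "\<dots> = ennreal (F (- a') (- b') c - - ((A * (- b') - B * (- a')) / D) / sqrt A)"
        by (intro nn_integral_FTC_atMost[OF _ dF _ Flim(2)])
           (auto simp: q0 less_imp_le intro!: divide_nonneg_nonneg dest!: sgn_le)
      also have "F (- a') (- b') c - - ((A * (- b') - B * (- a')) / D) / sqrt A = - M - F a' b' c"
        using D0 A q0[of c] by (simp add: F_def M_def field_simps)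
      finally show ?thesis .
    qed
    \<comment> \<open>Again no \<open>ennreal\<close> truncation may occur when the halves are
      added: \<open>F a' b'\<close> has its minimum at \<open>c\<close>. In the sum \<open>M\<close>
      cancels.\<close>
    have M_bound: "M - F a' b' c \<ge> 0" "- M - F a' b' c \<ge> 0"
    proof -
      have "((\<lambda>x. F a' b' x) \<longlongrightarrow> M) at_top" using Flim(1)[of a' b'] by (simp add: M_def)
      moreover have "F a' b' c \<le> F a' b' x" if "c \<le> x" for x
        using that dF sgn_ge q0
        by (intro DERIV_nonneg_imp_nondecreasing[of c x "F a' b'"])
           (auto intro!: exI[of _ "(a' * _ + b') / sqrt (q _) ^ 3"] simp: less_imp_le)
      ultimately show "M - F a' b' c \<ge> 0"
        by (simp, intro tendsto_lowerbound[of "F a' b'" M at_top])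
           (auto intro!: eventually_mono[OF eventually_ge_at_top[of c]])
      have "((\<lambda>x. F a' b' x) \<longlongrightarrow> - M) at_bot" using Flim(2)[of a' b'] by (simp add: M_def)
      moreover have "F a' b' c \<le> F a' b' x" if "x \<le> c" for x
        using that dF sgn_le q0
        by (intro DERIV_nonpos_imp_nonincreasing[of x c "F a' b'"])
           (auto intro!: exI[of _ "(a' * _ + b') / sqrt (q _) ^ 3"] divide_nonpos_nonneg simp: less_imp_le)
      ultimately show "- M - F a' b' c \<ge> 0"
        by (simp, intro tendsto_lowerbound[of "F a' b'" "- M" at_bot])
           (auto intro!: eventually_mono[OF eventually_le_at_bot[of c]])
    qed
    have "(\<integral>\<^sup>+x. ennreal (\<bar>a * x + b\<bar> / sqrt (q x) ^ 3) \<partial>lborel) =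
       ennreal (- M - F a' b' c) + ennreal (M - F a' b' c)"
      by (subst nn_integral_split_at[where a=c]) (simp_all add: I1 I2)
    also have "\<dots> = ennreal (2 * sqrt N / D)"
      using M_bound by (simp add: Fc flip: ennreal_plus)
    finally show ?thesis .
  qed
  then show ?thesis by (simp add: q_def D_def N_def)
qed

section \<open>The law of the centre in gnomonic coordinates\<close>

definition planar_density :: "real \<times> real \<Rightarrow> real" where
  "planar_density w = 1 / (pi * (1 + (fst w)\<^sup>2 + (snd w)\<^sup>2)\<^sup>2)"

lemma planar_density_measurable [measurable]: "planar_density \<in> borel_measurable borel"
  unfolding planar_density_def[abs_def] borel_prod[symmetric] by measurable

lemma planar_density_nonneg: "0 \<le> planar_density w"
  by (simp add: planar_density_def)

text \<open>The line is parametrised by its second coordinate instead of arc length. The resulting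
  factor \<open>1 + m^2\<close> is what later cancels the denominator of the kernel.\<close>

lemma nn_integral_planar_density_line:
  fixes c m :: real
  shows "(\<integral>\<^sup>+y. ennreal (planar_density (c + m * y, y)) \<partial>lborel) =
    ennreal ((1 + m\<^sup>2) / (2 * sqrt (1 + m\<^sup>2 + c\<^sup>2) ^ 3))"
proof -
  have D: "(1 + m\<^sup>2) * (1 + c\<^sup>2) - (c * m)\<^sup>2 = 1 + m\<^sup>2 + c\<^sup>2"
    by (simp add: algebra_simps power2_eq_square)
  have "(\<integral>\<^sup>+y. ennreal (planar_density (c + m * y, y)) \<partial>lborel) =
    (\<integral>\<^sup>+y. ennreal (1 / pi) * ennreal (1 / ((1 + m\<^sup>2) * y\<^sup>2 + 2 * (c * m) * y + (1 + c\<^sup>2))\<^sup>2) \<partial>lborel)"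
  proof (rule nn_integral_cong)
    fix y :: real
    have q: "1 + (c + m * y)\<^sup>2 + y\<^sup>2 = (1 + m\<^sup>2) * y\<^sup>2 + 2 * (c * m) * y + (1 + c\<^sup>2)"
      by (simp add: algebra_simps power2_eq_square)
    show "ennreal (planar_density (c + m * y, y)) =
      ennreal (1 / pi) * ennreal (1 / ((1 + m\<^sup>2) * y\<^sup>2 + 2 * (c * m) * y + (1 + c\<^sup>2))\<^sup>2)"
      unfolding planar_density_def fst_conv snd_conv q
      by (subst ennreal_mult[symmetric]) simp_all
  qed
  also have "\<dots> = ennreal (1 / pi) * ennreal ((1 + m\<^sup>2) * pi / (2 * sqrt (1 + m\<^sup>2 + c\<^sup>2) ^ 3))"
    by (subst nn_integral_cmult, simp, subst nn_integral_inverse_quadratic_squared)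
       (simp_all add: D add_pos_nonneg)
  also have "\<dots> = ennreal ((1 + m\<^sup>2) / (2 * sqrt (1 + m\<^sup>2 + c\<^sup>2) ^ 3))"
    by (simp flip: ennreal_mult)
  finally show ?thesis .
qed

text \<open>The kernel is homogeneous of degree -1 about the point \<open>(a, b)\<close>. Using the
  inverse slope \<open>s\<close> of the line through that point and the height \<open>y\<close> as
  coordinates, the Jacobian cancels the homogeneity and the kernel depends on \<open>s\<close>
  alone. The integral over \<open>y\<close> is then one of the density along a line, and the
  integral over \<open>s\<close> has the closed form found above.\<close>

lemma nn_integral_planar_density_kernel:
  fixes a b m n :: real
  shows "(\<integral>\<^sup>+w. ennreal (planar_density w * (\<bar>m * (fst w - a) + n * (snd w - b)\<bar> /
      ((fst w - a)\<^sup>2 + (snd w - b)\<^sup>2))) \<partial>lborel) =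
    ennreal (sqrt (m\<^sup>2 + n\<^sup>2 + (m * a + n * b)\<^sup>2) / (1 + a\<^sup>2 + b\<^sup>2))"
    (is "(\<integral>\<^sup>+w. ennreal (?g w) \<partial>lborel) = ?R")
proof -
  have [measurable]: "?g \<in> borel_measurable borel"
    using planar_density_measurable unfolding borel_prod[symmetric] by measurable
  have meas: "(\<lambda>w. ennreal (?g w)) \<in> borel_measurable borel" by measurable
  \<comment> \<open>The substitution \<open>x = a + (y - b) * s\<close> degenerates at
    \<open>y = b\<close>, which is a null set of heights.\<close>
  have slice: "(\<integral>\<^sup>+x. ennreal (?g (x, y)) \<partial>lborel) =
      (\<integral>\<^sup>+s. ennreal (planar_density (a + (y - b) * s, y) * (\<bar>m * s + n\<bar> / (1 + s\<^sup>2))) \<partial>lborel)" (is "_ = ?S")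
    if y: "y \<noteq> b" for y
  proof -
    have "(\<integral>\<^sup>+x. ennreal (?g (x, y)) \<partial>lborel) =
        ennreal \<bar>y - b\<bar> * (\<integral>\<^sup>+s. ennreal (?g (a + (y - b) * s, y)) \<partial>lborel)"
      by (rule nn_integral_real_affine) (use y in \<open>simp_all\<close>)
    also have "\<dots> = (\<integral>\<^sup>+s. ennreal \<bar>y - b\<bar> * ennreal (?g (a + (y - b) * s, y)) \<partial>lborel)"
      by (subst nn_integral_cmult) simp_all
    also have "\<dots> = ?S"
    proof (rule nn_integral_cong)
      fix s :: real
      define d where "d = y - b"
      have cancel: "\<bar>d\<bar> * (h * (\<bar>d * k\<bar> / (d\<^sup>2 * u))) = h * (\<bar>k\<bar> / u)" for h k u :: real
      proof -
        have "d\<^sup>2 = \<bar>d\<bar> * \<bar>d\<bar>" "\<bar>d\<bar> \<noteq> 0" using y by (simp_all add: power2_eq_square d_def)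
        then show ?thesis unfolding abs_mult by (simp add: mult.assoc del: abs_mult_self_eq)
      qed
      have "m * (a + (y - b) * s - a) + n * (y - b) = d * (m * s + n)"
           "(a + (y - b) * s - a)\<^sup>2 + (y - b)\<^sup>2 = d\<^sup>2 * (1 + s\<^sup>2)"
        by (simp_all add: d_def algebra_simps power2_eq_square)
      then have "\<bar>y - b\<bar> * ?g (a + (y - b) * s, y) =
          planar_density (a + (y - b) * s, y) * (\<bar>m * s + n\<bar> / (1 + s\<^sup>2))"
        by (simp only: fst_conv snd_conv cancel flip: d_def)
      then show "ennreal \<bar>y - b\<bar> * ennreal (?g (a + (y - b) * s, y)) =
          ennreal (planar_density (a + (y - b) * s, y) * (\<bar>m * s + n\<bar> / (1 + s\<^sup>2)))"
        by (simp flip: ennreal_mult add: planar_density_nonneg)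
    qed
    finally show ?thesis .
  qed
  have "(\<integral>\<^sup>+w. ennreal (?g w) \<partial>lborel) = (\<integral>\<^sup>+y. (\<integral>\<^sup>+x. ennreal (?g (x, y)) \<partial>lborel) \<partial>lborel)"
    unfolding lborel_prod[symmetric] 
    by (rule lborel_pair.nn_integral_snd[symmetric]) (simp only: lborel_prod measurable_lborel2 meas)
  also have "\<dots> = (\<integral>\<^sup>+y. (\<integral>\<^sup>+s. ennreal (planar_density (a + (y - b) * s, y) * (\<bar>m * s + n\<bar> / (1 + s\<^sup>2))) \<partial>lborel) \<partial>lborel)"
    by (intro nn_integral_cong_AE eventually_mono[OF AE_lborel_singleton[of b]] slice)
  also have "\<dots> = (\<integral>\<^sup>+s. (\<integral>\<^sup>+y. ennreal (planar_density (a + (y - b) * s, y) * (\<bar>m * s + n\<bar> / (1 + s\<^sup>2))) \<partial>lborel) \<partial>lborel)"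
    by (rule lborel_pair.Fubini'[symmetric]) simp
  also have "\<dots> = (\<integral>\<^sup>+s. ennreal (1/2) * ennreal (\<bar>m * s + n\<bar> / sqrt ((1 + b\<^sup>2) * s\<^sup>2 + 2 * (- (a * b)) * s + (1 + a\<^sup>2)) ^ 3) \<partial>lborel)"
  proof (rule nn_integral_cong)
    fix s :: real
    have s: "1 + s\<^sup>2 > 0" by (simp add: add_pos_nonneg)
    \<comment> \<open>With \<open>s\<close> fixed, \<open>y\<close> now runs along the line through
      \<open>(a, b)\<close> with inverse slope \<open>s\<close>.\<close>
    have eq: "a + (y - b) * s = (a - b * s) + s * y" for y by (simp add: algebra_simps)
    have q: "1 + s\<^sup>2 + (a - b * s)\<^sup>2 = (1 + b\<^sup>2) * s\<^sup>2 + 2 * (- (a * b)) * s + (1 + a\<^sup>2)"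
      by (simp add: algebra_simps power2_eq_square)
    have "(\<integral>\<^sup>+y. ennreal (planar_density (a + (y - b) * s, y) * (\<bar>m * s + n\<bar> / (1 + s\<^sup>2))) \<partial>lborel) =
      (\<integral>\<^sup>+y. ennreal (planar_density ((a - b * s) + s * y, y)) \<partial>lborel) * ennreal (\<bar>m * s + n\<bar> / (1 + s\<^sup>2))"
      unfolding eq
      by (subst nn_integral_multc[symmetric], simp, intro nn_integral_cong, subst ennreal_mult[symmetric])
         (simp_all add: planar_density_nonneg)
    also have "\<dots> = ennreal (1/2) * ennreal (\<bar>m * s + n\<bar> / sqrt (1 + s\<^sup>2 + (a - b * s)\<^sup>2) ^ 3)"
      unfolding nn_integral_planar_density_line using s
      by (subst (1 2) ennreal_mult[symmetric]) simp_all
    finally show "(\<integral>\<^sup>+y. ennreal (planar_density (a + (y - b) * s, y) * (\<bar>m * s + n\<bar> / (1 + s\<^sup>2))) \<partial>lborel) =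
      ennreal (1/2) * ennreal (\<bar>m * s + n\<bar> / sqrt ((1 + b\<^sup>2) * s\<^sup>2 + 2 * (- (a * b)) * s + (1 + a\<^sup>2)) ^ 3)"
      unfolding q .
  qed
  also have "\<dots> = ennreal (1/2) * ennreal (2 * sqrt ((1 + a\<^sup>2) * m\<^sup>2 - 2 * (- (a * b)) * m * n + (1 + b\<^sup>2) * n\<^sup>2) /
       ((1 + b\<^sup>2) * (1 + a\<^sup>2) - (- (a * b))\<^sup>2))"
  proof -
    have "(1 + b\<^sup>2) * (1 + a\<^sup>2) - (- (a * b))\<^sup>2 = 1 + a\<^sup>2 + b\<^sup>2"
      by (simp add: algebra_simps power2_eq_square)
    then show ?thesis
      by (subst nn_integral_cmult, simp, subst nn_integral_abs_linear_over_quadratic)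
         (simp_all add: add_pos_nonneg)
  qed
  also have "(1 + b\<^sup>2) * (1 + a\<^sup>2) - (- (a * b))\<^sup>2 = 1 + a\<^sup>2 + b\<^sup>2"
    by (simp add: algebra_simps power2_eq_square)
  also have "(1 + a\<^sup>2) * m\<^sup>2 - 2 * (- (a * b)) * m * n + (1 + b\<^sup>2) * n\<^sup>2 = m\<^sup>2 + n\<^sup>2 + (m * a + n * b)\<^sup>2"
    by (simp add: algebra_simps power2_eq_square)
  also have "ennreal (1/2) * ennreal (2 * sqrt (m\<^sup>2 + n\<^sup>2 + (m * a + n * b)\<^sup>2) / (1 + a\<^sup>2 + b\<^sup>2)) = ?R"
    by (subst ennreal_mult[symmetric]) simp_all
  finally show ?thesis .
qed

section \<open>The law of the centre as a probability measure\<close>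

definition planar_law :: "(real \<times> real) measure" where
  "planar_law = density lborel (\<lambda>w. ennreal (planar_density w))"

lemma sets_planar_law [measurable_cong, simp]: "sets planar_law = sets borel"
  by (simp add: planar_law_def)

lemma space_planar_law [simp]: "space planar_law = UNIV"
  by (simp add: planar_law_def)

interpretation planar_law: prob_space planar_law
proof
  have "emeasure planar_law UNIV = (\<integral>\<^sup>+w. ennreal (planar_density w) \<partial>lborel)"
    unfolding planar_law_def by (subst emeasure_density) simp_all
  also have "\<dots> = (\<integral>\<^sup>+x. (\<integral>\<^sup>+y. ennreal (planar_density (x + 0 * y, y)) \<partial>lborel) \<partial>lborel)"
    unfolding lborel_prod[symmetric] by (subst lborel.nn_integral_fst[symmetric]) (simp_all add: lborel_prod)
  \<comment> \<open>Vertical lines have \<open>m = 0\<close>; what remains is the absolute linear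
    integral with the linear factor constantly 1.\<close>
  also have "\<dots> = (\<integral>\<^sup>+x. ennreal (1/2) * ennreal (\<bar>0 * x + 1\<bar> / sqrt (1 * x\<^sup>2 + 2 * 0 * x + 1) ^ 3) \<partial>lborel)"
    unfolding nn_integral_planar_density_line
    by (intro nn_integral_cong, subst ennreal_mult[symmetric]) (simp_all add: add.commute)
  also have "\<dots> = ennreal (1/2) * ennreal 2"
    by (subst nn_integral_cmult, simp, subst nn_integral_abs_linear_over_quadratic) simp_all
  also have "\<dots> = 1"
    by (subst ennreal_mult[symmetric]) simp_all
  finally show "emeasure planar_law (space planar_law) = 1" by simp
qed

section \<open>Radial projection from a random centre\<close>

text \<open>\<open>D\<close> is the area of the parallelogram spanned by \<open>a\<close> and
  \<open>b\<close>, so the integrand is the angular speed, seen from the origin, of a point moving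
  along the segment. The lemma is applied twice: to the projected points in the plane and to the
  points of three-space themselves.\<close>

lemma nn_integral_angle:
  fixes a b :: "'a::real_inner"
  assumes D: "0 < D" "D\<^sup>2 = (norm a)\<^sup>2 * (norm b)\<^sup>2 - (a \<bullet> b)\<^sup>2"
  shows "(\<integral>\<^sup>+t. ennreal (D / (norm (a + t *\<^sub>R (b - a)))\<^sup>2) * indicator {0..1} t \<partial>lborel) =
    ennreal (arccos (sgn a \<bullet> sgn b))"
proof -
  define e where "e = b - a"
  \<comment> \<open>The line has distance \<open>D / norm e\<close> from the origin, so
    \<open>g t\<close> is the tangent of the angle measured from the foot of the
    perpendicular.\<close>
  define g where "g t = (a + t *\<^sub>R e) \<bullet> e / D" for t
  have ne: "e \<noteq> 0"
  proof
    assume "e = 0"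
    then have "b = a" by (simp add: e_def)
    then show False using D unfolding power2_norm_eq_inner by (simp add: power2_eq_square)
  qed
  \<comment> \<open>The Gram determinant of the moving point and the direction \<open>e\<close> does
    not depend on \<open>t\<close>.\<close>
  have gram: "D\<^sup>2 + ((a + t *\<^sub>R e) \<bullet> e)\<^sup>2 = (norm (a + t *\<^sub>R e))\<^sup>2 * (norm e)\<^sup>2" for t
    unfolding D(2) e_def power2_norm_eq_inner
    by (simp add: algebra_simps inner_commute[of b a] power2_eq_square)
  have pos: "0 < (norm (a + t *\<^sub>R e))\<^sup>2" for t
  proof -
    have "0 < (norm (a + t *\<^sub>R e))\<^sup>2 * (norm e)\<^sup>2"
      unfolding gram[symmetric] using D(1) by (simp add: add_pos_nonneg)
    then show ?thesis using ne by (simp add: zero_less_mult_iff)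
  qed
  have ab: "a \<noteq> 0" "b \<noteq> 0" using pos[of 0] pos[of 1] by (auto simp: e_def)
  have sq: "1 + (g t)\<^sup>2 = (norm (a + t *\<^sub>R e))\<^sup>2 * (norm e)\<^sup>2 / D\<^sup>2" for t
    using D(1) unfolding gram[symmetric] g_def by (simp add: power_divide add_divide_distrib)
  have "(\<integral>\<^sup>+t. ennreal (D / (norm (a + t *\<^sub>R e))\<^sup>2) * indicator {0..1} t \<partial>lborel) =
     ennreal (arctan (g 1) - arctan (g 0))"
  proof (rule nn_integral_FTC_Icc[where F = "\<lambda>t. arctan (g t)"])
    show "(\<lambda>t. D / (norm (a + t *\<^sub>R e))\<^sup>2) \<in> borel_measurable borel"
      by (intro borel_measurable_continuous_onI continuous_intros) (use pos in \<open>force\<close>)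
    fix t :: real
    have "(g has_real_derivative (norm e)\<^sup>2 / D) (at t)"
    proof -
      have g': "g = (\<lambda>t. (a \<bullet> e + t * (norm e)\<^sup>2) / D)"
        by (simp add: g_def fun_eq_iff inner_add_left power2_norm_eq_inner)
      show ?thesis unfolding g' using D(1) by (auto intro!: derivative_eq_intros)
    qed
    then have "((\<lambda>t. arctan (g t)) has_real_derivative inverse (1 + (g t)\<^sup>2) * ((norm e)\<^sup>2 / D)) (at t)"
      by (rule DERIV_chain2[OF DERIV_arctan])
    moreover have "inverse (1 + (g t)\<^sup>2) * ((norm e)\<^sup>2 / D) = D / (norm (a + t *\<^sub>R e))\<^sup>2"
      using D(1) ne unfolding sq by (simp add: power2_eq_square)
    ultimately show "((\<lambda>t. arctan (g t)) has_real_derivative D / (norm (a + t *\<^sub>R e))\<^sup>2) (at t)"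
      by simp
  qed (use D(1) in auto)
  also have "arctan (g 1) - arctan (g 0) = arccos (sgn a \<bullet> sgn b)"
  proof -
    have "g 1 - g 0 = (norm e)\<^sup>2 / D"
      by (simp add: g_def inner_add_left power2_norm_eq_inner flip: diff_divide_distrib)
    then have "g 0 \<le> g 1" using D(1) by (smt (verit) divide_nonneg_pos zero_le_power2)
    then have ge: "0 \<le> arctan (g 1) - arctan (g 0)" by (simp add: arctan_le_iff)
    \<comment> \<open>Only because the difference lies between 0 and \<open>pi\<close> does its
      cosine determine it.\<close>
    have le: "arctan (g 1) - arctan (g 0) \<le> pi"
      using arctan_bounded[of "g 1"] arctan_bounded[of "g 0"] by linarith
    have s0: "sqrt (1 + (g 0)\<^sup>2) = norm a * norm e / D"
      unfolding sq using D(1) by (simp add: real_sqrt_divide real_sqrt_mult)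
    have s1: "sqrt (1 + (g 1)\<^sup>2) = norm b * norm e / D"
      unfolding sq using D(1) by (simp add: real_sqrt_divide real_sqrt_mult e_def)
    have num: "D\<^sup>2 + (b \<bullet> e) * (a \<bullet> e) = (a \<bullet> b) * (norm e)\<^sup>2"
      unfolding D(2) e_def power2_norm_eq_inner
      by (simp add: algebra_simps inner_commute[of b a] power2_eq_square)
    have "cos (arctan (g 1) - arctan (g 0)) = (1 + g 1 * g 0) / (sqrt (1 + (g 1)\<^sup>2) * sqrt (1 + (g 0)\<^sup>2))"
      by (simp add: cos_diff cos_arctan sin_arctan add_divide_distrib)
    also have "1 + g 1 * g 0 = (a \<bullet> b) * (norm e)\<^sup>2 / D\<^sup>2"
      using D(1) unfolding num[symmetric] by (simp add: g_def e_def add_divide_distrib power2_eq_square)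
    also have "(a \<bullet> b) * (norm e)\<^sup>2 / D\<^sup>2 / (sqrt (1 + (g 1)\<^sup>2) * sqrt (1 + (g 0)\<^sup>2)) = sgn a \<bullet> sgn b"
      unfolding s0 s1 sgn_div_norm using D(1) ne ab by (simp add: power2_eq_square field_simps)
    finally show ?thesis using arccos_cos[OF ge le] by simp
  qed
  finally show ?thesis by (simp add: e_def)
qed

section \<open>Projection onto the boundary circle, in coordinates\<close>

text \<open>The gnomonic chart is the plane at height 1; the centre on the sphere is the unit vector
  along \<open>plane_point w\<close>.\<close>

definition plane_point :: "real \<times> real \<Rightarrow> real^3" where
  "plane_point w = fst w *\<^sub>R axis 1 1 + snd w *\<^sub>R axis 2 1 + axis 3 1"

text \<open>A multiple of the direction in which the gnomonic image of \<open>p\<close> lies from \<open>w\<close>; unlike that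
  image it also makes sense for \<open>p\<close> on the boundary.\<close>
definition slide :: "real \<times> real \<Rightarrow> real^3 \<Rightarrow> real^3" where
  "slide w p = p - p $ 3 *\<^sub>R plane_point w"

text \<open>Since \<open>p\<close> is \<open>slide w p\<close> plus \<open>p $ 3\<close> times the
  centre direction, the normalised slide is where the great circle ray from the centre through
  \<open>p\<close> meets the boundary. For \<open>p\<close> in the hemisphere the default arises
  only when \<open>p\<close> is the centre; any point of the circle would do.\<close>

definition radial :: "real \<times> real \<Rightarrow> real^3 \<Rightarrow> real^3" where
  "radial w p = (if slide w p = 0 then axis 1 1 else sgn (slide w p))"

lemma plane_point_nth [simp]:
  "plane_point w $ 1 = fst w" "plane_point w $ 2 = snd w" "plane_point w $ 3 = 1"
  by (simp_all add: plane_point_def axis_def)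

lemma slide_nth [simp]:
  "slide w p $ 1 = p $ 1 - p $ 3 * fst w" "slide w p $ 2 = p $ 2 - p $ 3 * snd w" "slide w p $ 3 = 0"
  by (simp_all add: slide_def)

lemma slide_segment: "slide w (p + t *\<^sub>R (q - p)) = slide w p + t *\<^sub>R (slide w q - slide w p)"
  by (simp add: slide_def algebra_simps)

lemma radial_boundary: "radial w p \<in> boundary_circle"
  by (auto simp: radial_def boundary_circle_def norm_sgn norm_axis_1) (simp_all add: sgn_div_norm axis_def)

lemma radial_fixes_boundary: "p \<in> boundary_circle \<Longrightarrow> radial w p = p"
  by (auto simp: radial_def boundary_circle_def slide_def sgn_div_norm)

lemma measurable_slide [measurable]: "(\<lambda>w. slide w p) \<in> borel_measurable borel"
  unfolding slide_def plane_point_def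
  by (intro borel_measurable_continuous_onI continuous_intros)

lemma measurable_radial [measurable]: "(\<lambda>w. radial w p) \<in> borel_measurable borel"
  unfolding radial_def sgn_div_norm by measurable

text \<open>Both slides have height 0, so the Gram determinant is the square of a 2 by 2
  determinant. Subtracting multiples of \<open>plane_point w\<close> from \<open>p\<close> and
  \<open>q\<close> does not change their triple product with it.\<close>

lemma gram_slide:
  "(norm (slide w p))\<^sup>2 * (norm (slide w q))\<^sup>2 - (slide w p \<bullet> slide w q)\<^sup>2 = (plane_point w \<bullet> cross3 p q)\<^sup>2"
proof -
  have "(norm (slide w p))\<^sup>2 * (norm (slide w q))\<^sup>2 - (slide w p \<bullet> slide w q)\<^sup>2 =
      (slide w p $ 1 * slide w q $ 2 - slide w p $ 2 * slide w q $ 1)\<^sup>2"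
    unfolding power2_norm_eq_inner inner_vec_def sum_3 slide_nth(3)
    by (simp add: power2_eq_square algebra_simps)
  also have "slide w p $ 1 * slide w q $ 2 - slide w p $ 2 * slide w q $ 1 = plane_point w \<bullet> cross3 p q"
    by (simp add: cross3_simps)
  finally show ?thesis .
qed

section \<open>Averages over the random centre\<close>

text \<open>For \<open>n\<close> the cross product of \<open>p\<close> and \<open>q\<close>, the
  excluded centres lie on the great circle through \<open>p\<close> and \<open>q\<close>. In the
  chart this is a line, a null set, as soon as \<open>n\<close> is not vertical.\<close>

lemma AE_planar_law_plane_point:
  fixes n :: "real^3"
  assumes "n $ 1 \<noteq> 0 \<or> n $ 2 \<noteq> 0"
  shows "AE w in planar_law. plane_point w \<bullet> n \<noteq> 0"
proof -
  have "negligible {w :: real \<times> real. (n $ 1, n $ 2) \<bullet> w = - n $ 3}"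
    using assms by (intro negligible_hyperplane) (auto simp: zero_prod_def)
  then have "AE w in lborel. w \<notin> {w :: real \<times> real. (n $ 1, n $ 2) \<bullet> w = - n $ 3}"
    by (intro AE_not_in) (simp add: negligible_iff_null_sets null_sets_completion_iff)
  then have "AE w in lborel. plane_point w \<bullet> n \<noteq> 0"
    by (rule eventually_mono) (auto simp: inner_vec_def sum_3 inner_prod_def algebra_simps)
  then show ?thesis
    unfolding planar_law_def by (subst AE_density) auto
qed

text \<open>The average over centres of the angular speed at the point \<open>r\<close> of the
  segment equals the speed seen from the origin of three-space. Positive height gives
  \<open>r\<close> the gnomonic image \<open>(a, b)\<close>, and orthogonality eliminates
  \<open>n $ 3\<close>, which brings the integrand into the form of the kernel integral.\<close>

lemma nn_integral_planar_law_speed: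
  assumes r: "r $ 3 > 0" and n: "n \<bullet> r = 0"
  shows "(\<integral>\<^sup>+w. ennreal (\<bar>plane_point w \<bullet> n\<bar> / (norm (slide w r))\<^sup>2) \<partial>planar_law) =
    ennreal (norm n / (norm r)\<^sup>2)"
proof -
  define a where "a = r $ 1 / r $ 3"
  define b where "b = r $ 2 / r $ 3"
  have r1: "r $ 1 = r $ 3 * a" and r2: "r $ 2 = r $ 3 * b" using r by (simp_all add: a_def b_def)
  have n3: "n $ 3 = - (n $ 1 * a + n $ 2 * b)"
  proof -
    have "r $ 3 * (n $ 1 * a + n $ 2 * b + n $ 3) = 0"
      using n by (simp add: inner_vec_def sum_3 r1 r2 algebra_simps)
    then show ?thesis using r by simp
  qed
  have num: "plane_point w \<bullet> n = n $ 1 * (fst w - a) + n $ 2 * (snd w - b)" for w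
    by (simp add: inner_vec_def sum_3 n3 algebra_simps)
  have den: "(norm (slide w r))\<^sup>2 = (r $ 3)\<^sup>2 * ((fst w - a)\<^sup>2 + (snd w - b)\<^sup>2)" for w
    unfolding power2_norm_eq_inner
    by (simp add: inner_vec_def sum_3 r1 r2 power2_eq_square algebra_simps)
  have norm_n: "norm n = sqrt ((n $ 1)\<^sup>2 + (n $ 2)\<^sup>2 + (n $ 1 * a + n $ 2 * b)\<^sup>2)"
    by (simp add: norm_eq_sqrt_inner inner_vec_def sum_3 n3 power2_eq_square algebra_simps)
  have norm_r: "(norm r)\<^sup>2 = (r $ 3)\<^sup>2 * (1 + a\<^sup>2 + b\<^sup>2)"
    unfolding power2_norm_eq_inner
    by (simp add: inner_vec_def sum_3 r1 r2 power2_eq_square algebra_simps)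
  let ?k = "\<lambda>w::real\<times>real. \<bar>n $ 1 * (fst w - a) + n $ 2 * (snd w - b)\<bar> / ((fst w - a)\<^sup>2 + (snd w - b)\<^sup>2)"
  have k [measurable]: "?k \<in> borel_measurable borel"
    unfolding borel_prod[symmetric] by measurable
  have "(\<integral>\<^sup>+w. ennreal (\<bar>plane_point w \<bullet> n\<bar> / (norm (slide w r))\<^sup>2) \<partial>planar_law) =
    (\<integral>\<^sup>+w. ennreal (1 / (r $ 3)\<^sup>2) * ennreal (planar_density w * ?k w) \<partial>lborel)"
    unfolding planar_law_def num den
  proof (subst nn_integral_density)
    show "(\<lambda>w. ennreal (\<bar>n $ 1 * (fst w - a) + n $ 2 * (snd w - b)\<bar> /
        ((r $ 3)\<^sup>2 * ((fst w - a)\<^sup>2 + (snd w - b)\<^sup>2)))) \<in> borel_measurable lborel"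
      unfolding lborel_prod[symmetric] by measurable
  qed (auto intro!: nn_integral_cong simp: planar_density_nonneg simp flip: ennreal_mult)
  also have "\<dots> = ennreal (1 / (r $ 3)\<^sup>2) * ennreal (norm n / (1 + a\<^sup>2 + b\<^sup>2))"
  proof (subst nn_integral_cmult)
    have "(\<lambda>w. planar_density w * ?k w) \<in> borel_measurable borel"
      using planar_density_measurable k by (rule borel_measurable_times)
    then show "(\<lambda>w. ennreal (planar_density w * ?k w)) \<in> borel_measurable lborel"
      by (simp only: measurable_lborel2 measurable_compose[OF _ measurable_ennreal])
  qed (simp only: nn_integral_planar_density_kernel norm_n)
  also have "\<dots> = ennreal (norm n / (norm r)\<^sup>2)"
    unfolding norm_r by (subst ennreal_mult[symmetric]) (simp_all add: mult.commute)
  finally show ?thesis .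
qed

text \<open>For almost every centre the angle is the integral of the planar angular speed along the
  segment. Exchanging the integrals averages the speed first, and the averaged speed integrates to
  the angle of \<open>p\<close> and \<open>q\<close> at the origin.\<close>

lemma nn_integral_radial_angle:
  assumes p: "p \<in> hemisphere" and q: "q \<in> hemisphere" and "p \<noteq> q"
    and nb: "p \<notin> boundary_circle \<or> q \<notin> boundary_circle"
  shows "(\<integral>\<^sup>+w. ennreal (sphere_dist (radial w p) (radial w q)) \<partial>planar_law) =
    ennreal (sphere_dist p q)"
proof -
  define n where "n = cross3 p q"
  have [simp]: "norm p = 1" "norm q = 1" and p3: "p $ 3 \<ge> 0" and q3: "q $ 3 \<ge> 0"
    using p q by (auto simp: hemisphere_def)
  have pos3: "p $ 3 > 0 \<or> q $ 3 > 0"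
    using nb p q p3 q3 by (auto simp: hemisphere_def boundary_circle_def)
  have orth: "n \<bullet> p = 0" "n \<bullet> q = 0" by (simp_all add: n_def dot_cross_self)
  \<comment> \<open>Parallel unit vectors are equal or antipodal, and antipodal points of the
    hemisphere both lie on its boundary.\<close>
  have n0: "n \<noteq> 0"
  proof
    assume "n = 0"
    then have "(p \<bullet> q)\<^sup>2 = 1" using norm_cross_dot[of p q] by (simp add: n_def)
    then have "p \<bullet> q = 1 \<or> p \<bullet> q = - 1" by (simp add: power2_eq_1_iff)
    moreover have "p = q" if "p \<bullet> q = 1"
      using that norm_cauchy_schwarz_eq[of p q] by simp
    moreover have "p = - q" if "p \<bullet> q = - 1"
      using that norm_cauchy_schwarz_eq[of p "- q"] by simp
    ultimately show False using \<open>p \<noteq> q\<close> pos3 p3 q3 by auto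
  qed
  \<comment> \<open>A vertical nonzero \<open>n\<close> is not orthogonal to a point of positive
    height.\<close>
  have n12: "n $ 1 \<noteq> 0 \<or> n $ 2 \<noteq> 0"
  proof (rule ccontr)
    assume "\<not> ?thesis"
    then have n1: "n $ 1 = 0" "n $ 2 = 0" by auto
    then have "n $ 3 = 0" using orth pos3 by (auto simp: inner_vec_def sum_3)
    then show False using n0 n1 by (simp add: vec_eq_iff forall_3)
  qed
  let ?v = "\<lambda>w t. \<bar>plane_point w \<bullet> n\<bar> / (norm (slide w (p + t *\<^sub>R (q - p))))\<^sup>2"
  have "(\<integral>\<^sup>+w. ennreal (sphere_dist (radial w p) (radial w q)) \<partial>planar_law) =
     (\<integral>\<^sup>+w. (\<integral>\<^sup>+t. ennreal (?v w t) * indicator {0..1} t \<partial>lborel) \<partial>planar_law)"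
    using AE_planar_law_plane_point[OF n12]
  proof (intro nn_integral_cong_AE, elim eventually_mono)
    fix w assume w: "plane_point w \<bullet> n \<noteq> 0"
    \<comment> \<open>The absolute triple product serves as \<open>D\<close> in the angle lemma. As
      it is nonzero, neither slide vanishes and the default of \<open>radial\<close> does not
      occur.\<close>
    have gram: "\<bar>plane_point w \<bullet> n\<bar>\<^sup>2 = (norm (slide w p))\<^sup>2 * (norm (slide w q))\<^sup>2 - (slide w p \<bullet> slide w q)\<^sup>2"
      by (simp add: gram_slide n_def)
    then have "slide w p \<noteq> 0" "slide w q \<noteq> 0" using w by auto
    then show "ennreal (sphere_dist (radial w p) (radial w q)) =
       (\<integral>\<^sup>+t. ennreal (?v w t) * indicator {0..1} t \<partial>lborel)"
      unfolding slide_segment using w gram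
      by (subst nn_integral_angle) (auto simp: sphere_dist_def radial_def)
  qed
  also have "\<dots> = (\<integral>\<^sup>+t. (\<integral>\<^sup>+w. ennreal (?v w t) * indicator {0..1} t \<partial>planar_law) \<partial>lborel)"
  proof -
    interpret pair_sigma_finite planar_law lborel ..
    have sets_eq: "sets (planar_law \<Otimes>\<^sub>M lborel) = sets borel"
      by (metis borel_prod sets_lborel sets_pair_measure_cong sets_planar_law)
    have [measurable]: "(\<lambda>x. plane_point (fst x) \<bullet> n) \<in> borel_measurable (planar_law \<Otimes>\<^sub>M lborel)"
      unfolding plane_point_def measurable_cong_sets[OF sets_eq refl]
      by (intro borel_measurable_continuous_onI continuous_intros)
    have [measurable]: "(\<lambda>x. norm (slide (fst x) (p + snd x *\<^sub>R (q - p)))) \<in> borel_measurable (planar_law \<Otimes>\<^sub>M lborel)"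
      unfolding plane_point_def slide_def measurable_cong_sets[OF sets_eq refl]
      by (intro borel_measurable_continuous_onI continuous_intros)
    show ?thesis
      by (intro Fubini'[symmetric]) (simp add: split_beta')
  qed
  also have "\<dots> = (\<integral>\<^sup>+t. ennreal (norm n / (norm (p + t *\<^sub>R (q - p)))\<^sup>2) * indicator {0..1} t \<partial>lborel)"
    \<comment> \<open>One endpoint may lie on the boundary, at height 0; the inner points of the
      segment have positive height.\<close>
    using AE_lborel_singleton[of 0] AE_lborel_singleton[of 1]
  proof (intro nn_integral_cong_AE, eventually_elim)
    fix t :: real assume t: "t \<noteq> 0" "t \<noteq> 1"
    show "(\<integral>\<^sup>+w. ennreal (?v w t) * indicator {0..1} t \<partial>planar_law) =
       ennreal (norm n / (norm (p + t *\<^sub>R (q - p)))\<^sup>2) * indicator {0..1} t"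
    proof (cases "t \<in> {0..1}")
      case True
      then have "0 < t" "t < 1" using t by auto
      then have "0 < (1 - t) * p $ 3 + t * q $ 3"
        using pos3 p3 q3 by (auto intro: add_pos_nonneg add_nonneg_pos)
      then have "(p + t *\<^sub>R (q - p)) $ 3 > 0" by (simp add: algebra_simps)
      moreover have "n \<bullet> (p + t *\<^sub>R (q - p)) = 0"
        by (simp add: inner_add_right inner_diff_right orth)
      ultimately show ?thesis
        using True by (simp add: nn_integral_planar_law_speed)
    qed simp
  qed
  also have "\<dots> = ennreal (sphere_dist p q)"
  proof -
    have "0 < norm n" "(norm n)\<^sup>2 = (norm p)\<^sup>2 * (norm q)\<^sup>2 - (p \<bullet> q)\<^sup>2"
      using n0 by (simp_all add: n_def norm_cross)
    then show ?thesis
      by (subst nn_integral_angle) (simp_all add: sphere_dist_def sgn_div_norm)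
  qed
  finally show ?thesis .
qed

section \<open>Wasserstein distance of image measures\<close>

lemma closed_measure_support: "closed (measure_support M)"
proof -
  have "- measure_support M = \<Union>{U. open U \<and> emeasure M U = 0}"
    by (auto simp: measure_support_def zero_less_iff_neq_zero)
  then show ?thesis by (auto simp: closed_def)
qed

lemma compact_countable_net:
  fixes C :: "'a::metric_space set"
  assumes "compact C"
  obtains N where "countable N" "N \<subseteq> C" "\<And>x e. x \<in> C \<Longrightarrow> 0 < e \<Longrightarrow> \<exists>d\<in>N. dist d x < e"
proof -
  have "\<forall>e>0. \<exists>k. finite k \<and> k \<subseteq> C \<and> C \<subseteq> (\<Union>x\<in>k. ball x e)"
    using assms by (intro seq_compact_imp_totally_bounded compact_imp_seq_compact)
  then have "\<forall>n. \<exists>k. finite k \<and> k \<subseteq> C \<and> C \<subseteq> (\<Union>x\<in>k. ball x (1 / real (Suc n)))"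
    by simp
  then obtain k where k: "\<And>n. finite (k n)" "\<And>n. k n \<subseteq> C" "\<And>n. C \<subseteq> (\<Union>x\<in>k n. ball x (1 / real (Suc n)))"
    by metis
  show thesis
  proof (rule that[of "\<Union>n. k n"])
    fix x and e :: real assume x: "x \<in> C" and "0 < e"
    then obtain n where n: "1 / real (Suc n) < e" using nat_approx_posE by blast
    from x k(3)[of n] obtain d where "d \<in> k n" "dist d x < 1 / real (Suc n)" by auto
    then show "\<exists>d\<in>\<Union>n. k n. dist d x < e" using n by (auto intro!: exI[of _ n] bexI[of _ d])
  qed (use k in \<open>auto simp: countable_finite\<close>)
qed

text \<open>Net points of \<open>C\<close> may lie outside \<open>S\<close>, so each net ball that
  meets \<open>S\<close> contributes a chosen point of \<open>S\<close> instead.\<close>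

lemma separable_subset_of_compact:
  fixes C :: "'a::metric_space set"
  assumes "compact C" and "S \<subseteq> C"
  shows "separable_space (top_of_set S)"
proof -
  obtain N where N: "countable N" "\<And>x e. x \<in> C \<Longrightarrow> 0 < e \<Longrightarrow> \<exists>d\<in>N. dist d x < e"
    using compact_countable_net[OF assms(1)] by metis
  define P where "P = {(d, n) \<in> N \<times> (UNIV :: nat set). ball d (1 / real (Suc n)) \<inter> S \<noteq> {}}"
  define pick where "pick = (\<lambda>(d, n :: nat). SOME s. s \<in> ball d (1 / real (Suc n)) \<inter> S)"
  have pick: "pick (d, n) \<in> ball d (1 / real (Suc n)) \<inter> S" if "(d, n) \<in> P" for d n
    using that some_in_eq[of "ball d (1 / real (Suc n)) \<inter> S"] by (simp add: P_def pick_def)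
  have "countable P"
    using N(1) by (rule countable_subset[rotated, OF countable_SIGMA]) (auto simp: P_def)
  have sub: "pick ` P \<subseteq> S" using pick by fastforce
  have dense: "S \<subseteq> closure (pick ` P)"
  proof
    fix x assume x: "x \<in> S"
    show "x \<in> closure (pick ` P)"
      unfolding closure_approachable
    proof (intro allI impI)
      fix e :: real assume "0 < e"
      then obtain n where n: "1 / real (Suc n) < e / 2" using nat_approx_posE[of "e / 2"] by auto
      obtain d where d: "d \<in> N" "dist d x < 1 / real (Suc n)"
        using N(2)[of x "1 / real (Suc n)"] x assms(2) by auto
      then have dn: "(d, n) \<in> P" using x by (auto simp: P_def)
      have "dist (pick (d, n)) x < e"
        using pick[OF dn] d n dist_triangle3[of "pick (d, n)" x d] by auto
      then show "\<exists>y\<in>pick ` P. dist y x < e" using dn by blast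
    qed
  qed
  show ?thesis
    unfolding separable_space_def
  proof (intro exI conjI)
    show "countable (pick ` P)" using \<open>countable P\<close> by simp
    show "pick ` P \<subseteq> topspace (top_of_set S)" using sub by simp
    show "top_of_set S closure_of (pick ` P) = topspace (top_of_set S)"
      using dense sub by (simp add: closure_of_subtopology Int_absorb1 Int_absorb2)
  qed
qed

text \<open>The support lies in \<open>C\<close>, hence is separable. It has full measure because
  each point of \<open>C\<close> outside it lies in a null ball taken from a countable family,
  although the whole space may be non-separable.\<close>

lemma borel_probs_compactI:
  fixes M :: "'a::metric_space measure"
  assumes M: "prob_space M" "sets M = sets borel"
    and C: "compact C" "AE x in M. x \<in> C"
  shows "M \<in> borel_probs"
proof -
  interpret prob_space M by fact
  have borel: "A \<in> sets M" if "open A \<or> closed A" for A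
    using that M(2) by (metis borel_closed borel_open)
  have sub: "measure_support M \<subseteq> C"
  proof (rule ccontr)
    assume "\<not> ?thesis"
    then obtain x where x: "x \<in> measure_support M" "x \<in> - C" by auto
    have "emeasure M (- C) = 0"
      using emeasure_eq_0_AE[of "\<lambda>x. x \<in> - C" M] C(2) sets_eq_imp_space_eq[OF M(2)] by (simp add: Compl_eq)
    moreover have "open (- C)" using C(1) compact_imp_closed by blast
    ultimately show False using x by (fastforce simp: measure_support_def)
  qed
  obtain N where N: "countable N" "\<And>x e. x \<in> C \<Longrightarrow> 0 < e \<Longrightarrow> \<exists>d\<in>N. dist d x < e"
    using compact_countable_net[OF C(1)] by metis
  \<comment> \<open>\<open>Z\<close> indexes the null balls around net points with radii
    \<open>1 / (n + 1)\<close>; countability makes their union null.\<close>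
  define Z where "Z = {(d, n) \<in> N \<times> (UNIV :: nat set). emeasure M (ball d (1 / real (Suc n))) = 0}"
  have "countable Z"
    using N(1) by (rule countable_subset[rotated, OF countable_SIGMA]) (auto simp: Z_def)
  then have "(\<Union>z\<in>Z. ball (fst z) (1 / real (Suc (snd z)))) \<in> null_sets M"
    by (intro null_sets_UN') (auto simp: Z_def null_sets_def borel)
  then have "AE x in M. x \<notin> (\<Union>z\<in>Z. ball (fst z) (1 / real (Suc (snd z))))" by (rule AE_not_in)
  with C(2) have "AE x in M. x \<in> measure_support M"
  proof eventually_elim
    fix x assume x: "x \<in> C" "x \<notin> (\<Union>z\<in>Z. ball (fst z) (1 / real (Suc (snd z))))"
    show "x \<in> measure_support M"
    proof (rule ccontr)
      assume "x \<notin> measure_support M"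
      then obtain U where U: "open U" "x \<in> U" "emeasure M U = 0"
        by (auto simp: measure_support_def zero_less_iff_neq_zero)
      then obtain e where e: "0 < e" "ball x e \<subseteq> U" by (meson open_contains_ball)
      then obtain n where n: "1 / real (Suc n) < e / 2" using nat_approx_posE[of "e / 2"] by auto
      obtain d where d: "d \<in> N" "dist d x < 1 / real (Suc n)"
        using N(2)[of x "1 / real (Suc n)"] x(1) by auto
      have "ball d (1 / real (Suc n)) \<subseteq> ball x e"
      proof
        fix y assume "y \<in> ball d (1 / real (Suc n))"
        then show "y \<in> ball x e" using d n dist_triangle[of x y d] by (auto simp: dist_commute)
      qed
      then have "emeasure M (ball d (1 / real (Suc n))) \<le> emeasure M U"
        using e U by (intro emeasure_mono borel) auto
      then have "(d, n) \<in> Z" using d U by (simp add: Z_def)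
      then show False using x(2) d by force
    qed
  qed
  then have "emeasure M (measure_support M) = 1"
    using borel closed_measure_support by (intro emeasure_eq_1_AE) auto
  with M separable_subset_of_compact[OF C(1) sub] show ?thesis
    by (simp add: borel_probs_def)
qed

section \<open>Laws of random points and the couplings they induce\<close>

lemma (in prob_space) distr_in_borel_probs:
  assumes g: "g \<in> measurable M borel" and C: "compact C" "\<And>w. w \<in> space M \<Longrightarrow> g w \<in> C"
  shows "distr M borel g \<in> borel_probs"
proof (rule borel_probs_compactI)
  show "prob_space (distr M borel g)" using g by (rule prob_space_distr)
  show "AE x in distr M borel g. x \<in> C"
    using C g compact_imp_closed[OF C(1)] by (subst AE_distr_iff) auto
qed (use C in auto)

text \<open>The law of \<open>h\<close> couples the laws of its components. \<open>h\<close> is one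
  map into the product because Borel measurability there can be stronger than measurability of both
  components.\<close>

lemma (in prob_space) wasserstein_dist_distr_le:
  fixes h :: "'a \<Rightarrow> 'b::metric_space \<times> 'b"
  assumes h: "h \<in> measurable M borel" and C: "compact C" "\<And>w. w \<in> space M \<Longrightarrow> h w \<in> C"
  shows "wasserstein_dist (distr M borel (\<lambda>w. fst (h w))) (distr M borel (\<lambda>w. snd (h w))) \<le>
    (\<integral>\<^sup>+w. ennreal (dist (fst (h w)) (snd (h w))) \<partial>M)"
proof -
  have [measurable]: "(fst :: 'b \<times> 'b \<Rightarrow> 'b) \<in> measurable borel borel"
    "(snd :: 'b \<times> 'b \<Rightarrow> 'b) \<in> measurable borel borel"
    "(\<lambda>z :: 'b \<times> 'b. dist (fst z) (snd z)) \<in> borel_measurable borel"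
    by (intro borel_measurable_continuous_onI continuous_intros)+
  have "distr M borel h \<in> couplings (distr M borel (\<lambda>w. fst (h w))) (distr M borel (\<lambda>w. snd (h w)))"
    using distr_in_borel_probs[OF h C] h by (auto simp: couplings_def distr_distr comp_def)
  then have "wasserstein_dist (distr M borel (\<lambda>w. fst (h w))) (distr M borel (\<lambda>w. snd (h w))) \<le>
      (\<integral>\<^sup>+z. ennreal (dist (fst z) (snd z)) \<partial>distr M borel h)"
    unfolding wasserstein_dist_def by (rule INF_lower)
  also have "\<dots> = (\<integral>\<^sup>+w. ennreal (dist (fst (h w)) (snd (h w))) \<partial>M)"
    by (rule nn_integral_distr[OF h]) measurable
  finally show ?thesis .
qed

lemma (in prob_space) distr_in_borel_probs1:
  fixes g :: "'a \<Rightarrow> 'b::metric_space"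
  assumes g: "g \<in> measurable M borel" and C: "compact C" "\<And>w. w \<in> space M \<Longrightarrow> g w \<in> C"
  shows "distr M borel g \<in> borel_probs1"
  unfolding borel_probs1_def
proof (intro CollectI conjI allI)
  show "distr M borel g \<in> borel_probs" using assms by (rule distr_in_borel_probs)
  fix x :: 'b
  have "(\<lambda>y. (y, x)) \<in> measurable borel borel"
    by (intro borel_measurable_continuous_onI continuous_intros)
  from measurable_compose[OF g this] have h: "(\<lambda>w. (g w, x)) \<in> measurable M borel" .
  obtain B where B: "\<And>y. y \<in> C \<Longrightarrow> dist x y \<le> B"
    using compact_imp_bounded[OF C(1)] unfolding bounded_any_center[of _ x] by auto
  have "wasserstein_dist (distr M borel g) (return borel x) \<le> (\<integral>\<^sup>+w. ennreal (dist (g w) x) \<partial>M)"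
    \<comment> \<open>The Dirac measure is the law of a constant map, and distances to
      \<open>x\<close> are bounded on \<open>C\<close>.\<close>
    using wasserstein_dist_distr_le[OF h, of "C \<times> {x}"] C
    by (simp add: compact_Times distr_const)
  also have "\<dots> \<le> (\<integral>\<^sup>+w. ennreal B \<partial>M)"
    using B C by (intro nn_integral_mono ennreal_leI) (simp add: dist_commute[of _ x])
  also have "\<dots> < \<infinity>" by (simp add: emeasure_space_1)
  finally show "wasserstein_dist (distr M borel g) (return borel x) < \<infinity>" .
qed

section \<open>The extension\<close>

text \<open>As \<open>y\<close> tends to \<open>x\<close> in the Euclidean sense,
  \<open>y \<bullet> x\<close> tends to 1 and its \<open>arccos\<close> to 0, which squeezes the
  distance of the images.\<close>

lemma sphere_lipschitz_on_continuous:
  fixes \<eta> :: "real^3 \<Rightarrow> 'a::metric_space"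
  assumes "sphere_lipschitz_on L S \<eta>" and S: "S \<subseteq> sphere 0 1"
  shows "continuous_on S \<eta>"
  unfolding continuous_on_def
proof
  fix x assume x: "x \<in> S"
  have "\<bar>y \<bullet> x\<bar> \<le> 1" if "y \<in> S" for y
    using Cauchy_Schwarz_ineq2[of y x] subsetD[OF S that] subsetD[OF S x] by simp
  then have "continuous_on S (\<lambda>y. L * arccos (y \<bullet> x))"
    by (intro continuous_intros) (auto simp: abs_le_iff)
  then have "((\<lambda>y. L * arccos (y \<bullet> x)) \<longlongrightarrow> L * arccos (x \<bullet> x)) (at x within S)"
    using x by (simp add: continuous_on_def)
  also have "x \<bullet> x = 1" using x S by (auto simp: norm_eq_1)
  finally have lim: "((\<lambda>y. L * arccos (y \<bullet> x)) \<longlongrightarrow> 0) (at x within S)" by simp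
  have "((\<lambda>y. dist (\<eta> y) (\<eta> x)) \<longlongrightarrow> 0) (at x within S)"
  proof (rule tendsto_sandwich[OF _ _ tendsto_const lim])
    show "\<forall>\<^sub>F y in at x within S. dist (\<eta> y) (\<eta> x) \<le> L * arccos (y \<bullet> x)"
      using assms(1) x by (auto simp: sphere_lipschitz_on_def sphere_dist_def eventually_at_filter)
  qed simp
  then show "(\<eta> \<longlongrightarrow> \<eta> x) (at x within S)" by (rule tendsto_dist_iff[THEN iffD2])
qed

lemma boundary_circle_subset_sphere: "boundary_circle \<subseteq> sphere 0 1"
  by (auto simp: boundary_circle_def)

lemma compact_boundary_circle: "compact boundary_circle"
proof -
  have "boundary_circle = sphere 0 1 \<inter> {x. x $ 3 = 0}" by (auto simp: boundary_circle_def)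
  moreover have "closed {x :: real^3. x $ 3 = 0}"
    by (intro closed_Collect_eq continuous_intros)
  ultimately show ?thesis by (metis compact_Int_closed compact_sphere)
qed

theorem theorem1p1:
  fixes \<eta> :: "real^3 \<Rightarrow> 'a::metric_space" and L :: real
  assumes "\<exists>b :: 'a measure \<Rightarrow> 'a. contracting_barycenter_map b"
    and "L \<ge> 0"
    and "sphere_lipschitz_on L boundary_circle \<eta>"
  shows "\<exists>f :: real^3 \<Rightarrow> 'a. sphere_lipschitz_on L hemisphere f \<and>
           (\<forall>x\<in>boundary_circle. f x = \<eta> x)"
proof -
  from assms(1) obtain b :: "'a measure \<Rightarrow> 'a" where
    b: "\<And>M N. M \<in> borel_probs1 \<Longrightarrow> N \<in> borel_probs1 \<Longrightarrow> ennreal (dist (b M) (b N)) \<le> wasserstein_dist M N"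
       "\<And>x. b (return borel x) = x"
    unfolding contracting_barycenter_map_def by blast
  have lip: "dist (\<eta> x) (\<eta> y) \<le> L * sphere_dist x y" if "x \<in> boundary_circle" "y \<in> boundary_circle" for x y
    using assms(3) that by (simp add: sphere_lipschitz_on_def)
  have cont: "continuous_on boundary_circle \<eta>"
    using assms(3) boundary_circle_subset_sphere by (rule sphere_lipschitz_on_continuous)
  let ?S = "boundary_circle \<times> boundary_circle"
  have compact: "compact ((\<lambda>z. (\<eta> (fst z), \<eta> (snd z))) ` ?S)" "compact (\<eta> ` boundary_circle)"
    by (intro compact_continuous_image compact_Times compact_boundary_circle continuous_intros
          continuous_on_compose2[OF cont] cont; auto)+
  \<comment> \<open>The coupling: the same centre \<open>w\<close> serves both points.\<close>
  define h where "h p q w = (\<eta> (radial w p), \<eta> (radial w q))" for p q w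
  have h: "h p q \<in> measurable planar_law borel" for p q
  proof -
    \<comment> \<open>\<open>\<eta>\<close> is controlled only on the circle, so measurability
      passes through the restricted Borel space. Continuity of the pair map gives measurability for
      the full Borel algebra of the product.\<close>
    have "(\<lambda>z. (\<eta> (fst z), \<eta> (snd z))) \<in> borel_measurable (restrict_space borel ?S)"
      by (intro borel_measurable_continuous_on_restrict continuous_intros continuous_on_compose2[OF cont]) auto
    moreover have "(\<lambda>w. (radial w p, radial w q)) \<in> measurable planar_law (restrict_space borel ?S)"
      by (intro measurable_restrict_space2) (auto simp: radial_boundary)
    ultimately have "(\<lambda>w. (\<lambda>z. (\<eta> (fst z), \<eta> (snd z))) (radial w p, radial w q)) \<in> measurable planar_law borel"
      by (rule measurable_compose[rotated])
    then show ?thesis by (simp add: h_def[abs_def])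
  qed
  have \<eta>_radial: "(\<lambda>w. \<eta> (radial w p)) \<in> measurable planar_law borel" for p
  proof -
    have "\<eta> \<in> borel_measurable (restrict_space borel boundary_circle)"
      by (intro borel_measurable_continuous_on_restrict cont)
    moreover have "(\<lambda>w. radial w p) \<in> measurable planar_law (restrict_space borel boundary_circle)"
      by (intro measurable_restrict_space2) (auto simp: radial_boundary)
    ultimately show ?thesis by (rule measurable_compose[rotated])
  qed
  define \<mu> where "\<mu> p = distr planar_law borel (\<lambda>w. \<eta> (radial w p))" for p
  have \<mu>: "\<mu> p \<in> borel_probs1" for p
    unfolding \<mu>_def using \<eta>_radial compact(2)
    by (rule planar_law.distr_in_borel_probs1) (simp add: radial_boundary)
  \<comment> \<open>A boundary point is fixed by every projection, so its law is the Dirac measure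
    at \<open>\<eta> p\<close>.\<close>
  have \<mu>_boundary: "b (\<mu> p) = \<eta> p" if "p \<in> boundary_circle" for p
    using that by (simp add: \<mu>_def radial_fixes_boundary planar_law.distr_const b)
  have "dist (b (\<mu> p)) (b (\<mu> q)) \<le> L * sphere_dist p q" if pq: "p \<in> hemisphere" "q \<in> hemisphere" for p q
  proof -
    have "\<bar>p \<bullet> q\<bar> \<le> 1" using Cauchy_Schwarz_ineq2[of p q] pq by (simp add: hemisphere_def)
    then have dist_nonneg: "0 \<le> sphere_dist p q" by (simp add: sphere_dist_def arccos_lbound abs_le_iff)
    show ?thesis
    \<comment> \<open>The averaged angle formula is stated for distinct points not both on the
      circle. Two circle points are covered by the Lipschitz bound on \<open>\<eta>\<close>.\<close>
    proof (cases "p = q \<or> (p \<in> boundary_circle \<and> q \<in> boundary_circle)")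
      case True
      with dist_nonneg show ?thesis using \<mu>_boundary lip assms(2) by auto
    next
      case False
      have radial_inner: "\<bar>radial w p \<bullet> radial w q\<bar> \<le> 1" for w
      proof -
        have "norm (radial w p) = 1" "norm (radial w q) = 1"
          using radial_boundary[of w] by (auto simp: boundary_circle_def)
        then show ?thesis
          using Cauchy_Schwarz_ineq2[of "radial w p" "radial w q"] by simp
      qed
      then have radial_dist: "0 \<le> sphere_dist (radial w p) (radial w q)" for w
        by (simp add: sphere_dist_def arccos_lbound abs_le_iff)
      have "ennreal (dist (b (\<mu> p)) (b (\<mu> q))) \<le> wasserstein_dist (\<mu> p) (\<mu> q)"
        by (intro b \<mu>)
      also have "\<dots> \<le> (\<integral>\<^sup>+w. ennreal (dist (\<eta> (radial w p)) (\<eta> (radial w q))) \<partial>planar_law)"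
        using planar_law.wasserstein_dist_distr_le[OF h compact(1), of p q]
        by (force simp: h_def \<mu>_def radial_boundary)
      also have "\<dots> \<le> (\<integral>\<^sup>+w. ennreal L * ennreal (sphere_dist (radial w p) (radial w q)) \<partial>planar_law)"
        using lip assms(2) radial_dist
        by (intro nn_integral_mono) (simp add: radial_boundary flip: ennreal_mult)
      also have "\<dots> = ennreal L * ennreal (sphere_dist p q)"
      proof (subst nn_integral_cmult)
        show "(\<lambda>w. ennreal (sphere_dist (radial w p) (radial w q))) \<in> borel_measurable planar_law"
        proof -
          \<comment> \<open>Continuity of \<open>arccos\<close> is available on
            \<open>{- 1..1}\<close>, where the inner products lie.\<close>
          have "arccos \<in> borel_measurable (restrict_space borel {- 1..1})"
            by (intro borel_measurable_continuous_on_restrict continuous_on_arccos')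
          moreover have "(\<lambda>w. radial w p \<bullet> radial w q) \<in> measurable planar_law (restrict_space borel {- 1..1})"
            using radial_inner by (intro measurable_restrict_space2) (auto simp: abs_le_iff)
          ultimately have "(\<lambda>w. arccos (radial w p \<bullet> radial w q)) \<in> borel_measurable planar_law"
            by (rule measurable_compose[rotated])
          then show ?thesis unfolding sphere_dist_def by measurable
        qed
      qed (use False pq in \<open>simp add: nn_integral_radial_angle\<close>)
      also have "\<dots> = ennreal (L * sphere_dist p q)"
        using assms(2) by (simp add: ennreal_mult')
      finally show ?thesis
        using dist_nonneg assms(2) by (simp add: ennreal_le_iff)
    qed
  qed
  then have "sphere_lipschitz_on L hemisphere (\<lambda>p. b (\<mu> p))"
    using assms(2) by (simp add: sphere_lipschitz_on_def)
  with \<mu>_boundary show ?thesis by blast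
qed

end
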